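(* Let $0<\alpha<1$. Let $m=m(t,\rho)$ be a classical solution of $$m_t+m\,(m_\rho)^\alpha=0,\qquad t>0,\ \rho>0,$$ with initial datum $m_0$, $m_0(0)=0$, and let $u_0=(m_0)_\rho\ge0$. As long as the characteristics $$\rho(t)=\rho_0+\alpha\, m_0(\rho_0)\,u_0(\rho_0)^{\alpha-1}\,t$$ do not cross, the solution is given by $$m(t,\rho(t))=m_0(\rho_0)\bigl(1+\alpha u_0(\rho_0)^\alpha t\bigr)^{1-\frac1\alpha}$$ and its derivative $u=m_\rho$ by $$u(t,\rho(t))=\bigl(u_0(\rho_0)^{-\alpha}+\alpha t\bigr)^{-\frac1\alpha}.$$
   Context: The variables are time $t\ge0$ and a volume variable $\rho\ge0$; $m$ is a mass function, so $m_0(\rho)=\int_0^\rho u_0(s)\,ds$ and $m_\rho\ge 0$. A classical solution is one that is continuously differentiable and satisfies the equation pointwise. For each starting point $\rho_0\ge 0$, the line $t\mapsto\rho(t)$ is the characteristic emanating from $\rho_0$. If $u_0(\rho_0)=0$, the characteristic is understood to be the constant line $\rho(t)\equiv\rho_0$, along which $u=0$ and $m=m_0(\rho_0)$. "As long as the characteristics do not cross" means: on a time interval $[0,T]$ such that for every $t\in[0,T]$ distinct starting points $\rho_0$ give distinct values $\rho(t)$. *)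

theory Defs
  imports "HOL-Analysis.Analysis"
begin

(* Classical solution of m_t + m (m_rho)^alpha = 0 on 0 < t <= T, rho > 0, with initial datum m0:
   continuous up to t = 0 and rho = 0, continuously differentiable for positive t and rho
   (one-sidedly in time at t = T), with m_rho >= 0 because m is a mass function.
   With m_rho = 0 the nonlinearity is 0 powr alpha = 0, as intended. *)
definition classical_solution ::
    "real \<Rightarrow> real \<Rightarrow> (real \<Rightarrow> real) \<Rightarrow> (real \<Rightarrow> real \<Rightarrow> real) \<Rightarrow> bool" where
  "classical_solution \<alpha> T m0 m \<longleftrightarrow>
     continuous_on ({0..T} \<times> {0..}) (\<lambda>(t, \<rho>). m t \<rho>) \<and>
     (\<forall>\<rho>\<ge>0. m 0 \<rho> = m0 \<rho>) \<and>
     (\<exists>m_t m_\<rho> :: real \<Rightarrow> real \<Rightarrow> real.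
        continuous_on ({0<..T} \<times> {0<..}) (\<lambda>(t, \<rho>). m_t t \<rho>) \<and>
        continuous_on ({0<..T} \<times> {0<..}) (\<lambda>(t, \<rho>). m_\<rho> t \<rho>) \<and>
        (\<forall>t\<in>{0<..T}. \<forall>\<rho>>0.
           ((\<lambda>s. m s \<rho>) has_real_derivative m_t t \<rho>) (at t within {0..T}) \<and>
           ((\<lambda>r. m t r) has_real_derivative m_\<rho> t \<rho>) (at \<rho>) \<and>
           m_\<rho> t \<rho> \<ge> 0 \<and>
           m_t t \<rho> + m t \<rho> * m_\<rho> t \<rho> powr \<alpha> = 0))"

definition characteristic ::
    "real \<Rightarrow> (real \<Rightarrow> real) \<Rightarrow> (real \<Rightarrow> real) \<Rightarrow> real \<Rightarrow> real \<Rightarrow> real" where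
  "characteristic \<alpha> m0 u0 \<rho>0 t =
     (if u0 \<rho>0 = 0 then \<rho>0
      else \<rho>0 + \<alpha> * m0 \<rho>0 * u0 \<rho>0 powr (\<alpha> - 1) * t)"

definition characteristics_do_not_cross ::
    "real \<Rightarrow> (real \<Rightarrow> real) \<Rightarrow> (real \<Rightarrow> real) \<Rightarrow> real \<Rightarrow> bool" where
  "characteristics_do_not_cross \<alpha> m0 u0 T \<longleftrightarrow>
     (\<forall>t\<in>{0..T}. inj_on (\<lambda>\<rho>0. characteristic \<alpha> m0 u0 \<rho>0 t) {0..})"

(* For u0 = 0 the formula is read with 0^(-alpha) = infinity, so that u = 0; the case distinction
   is needed because 0 powr (-alpha) = 0 in HOL. *)
definition u_along_characteristic ::
    "real \<Rightarrow> (real \<Rightarrow> real) \<Rightarrow> real \<Rightarrow> real \<Rightarrow> real" where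
  "u_along_characteristic \<alpha> u0 \<rho>0 t =
     (if u0 \<rho>0 = 0 then 0
      else (u0 \<rho>0 powr (- \<alpha>) + \<alpha> * t) powr (- (1 / \<alpha>)))"

end

theory Submission imports Defs begin

text \<open>
  Put \<open>\<gamma> = \<alpha> / (1 - \<alpha>)\<close>. Where \<open>m > 0\<close>, the function \<open>v = m powr (- \<gamma>)\<close> solves
  \<open>v\<^sub>t = \<gamma> powr (1 - \<alpha>) * (- v\<^sub>\<rho>) powr \<alpha>\<close>, a Hamilton--Jacobi equation without zeroth-order
  term, and it satisfies the Hopf--Lax formula
  \<open>v t x = min\<^sub>y (m0 y powr (- \<gamma>) + (\<alpha> t) powr (1 + \<gamma>) * (x - y) powr (- \<gamma>))\<close> over
  \<open>y < x\<close>. The inequality \<open>\<le>\<close> comes from integrating along straight lines, \<open>\<ge>\<close> from a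
  minimum principle; the boundary does not matter because both summands blow up there. The
  first-order condition says that the characteristic from a minimiser \<open>y\<close> passes through
  \<open>(t, x)\<close>, so the no-crossing hypothesis identifies \<open>y\<close>. In particular, no-crossing excludes
  \<open>u0 \<rho>0 = 0 < m0 \<rho>0\<close> when \<open>T > 0\<close>. At \<open>\<rho> = 0\<close> the derivative is found by comparing \<open>m0\<close>
  with linear data, since \<open>u0\<close> need not be continuous.
\<close>

section \<open>Inequalities for real powers\<close>

text \<open>This bounds the concave Legendre transform, the supremum over \<open>q\<close> of
  \<open>q powr \<alpha> - s * q\<close>. Weighted AM-GM between \<open>q\<close> and the maximiser
  gives it.\<close>

lemma powr_legendre_bound:
  fixes \<alpha> s q :: real
  assumes "0 < \<alpha>" "\<alpha> < 1" "0 < s" "0 \<le> q"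
  defines "\<gamma> \<equiv> \<alpha> / (1 - \<alpha>)"
  shows "\<gamma> * (q powr \<alpha> - s * q) \<le> \<alpha> powr (1 + \<gamma>) * s powr (- \<gamma>)"
proof (cases "q = 0")
  case False
  \<comment> \<open>The maximiser of \<open>q powr \<alpha> - s * q\<close>, obtained from
    \<open>\<alpha> * q powr (\<alpha> - 1) = s\<close>. Young's inequality below is an equality at
    \<open>q = k\<close>.\<close>
  define k where "k = (\<alpha> / s) powr (1 + \<gamma>)"
  have "(1 + \<gamma>) * (1 - \<alpha>) = 1"
    using assms by (simp add: field_simps)
  then have k: "k powr (1 - \<alpha>) = \<alpha> / s" "k > 0"
    using assms by (simp_all add: k_def powr_powr)
  have "q powr \<alpha> * k powr (1 - \<alpha>) \<le> \<alpha> * q + (1 - \<alpha>) * k"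
    by (rule Youngs_inequality_0) (use assms False k in auto)
  then have "q powr \<alpha> - s * q \<le> s * k * (1 - \<alpha>) / \<alpha>"
    using assms k by (simp add: field_simps)
  then have "\<gamma> * (q powr \<alpha> - s * q) \<le> \<gamma> * (s * k * (1 - \<alpha>) / \<alpha>)"
    using assms by (intro mult_left_mono) auto
  also have "\<dots> = s * k"
    using assms by (simp add: field_simps)
  also have "\<dots> = \<alpha> powr (1 + \<gamma>) * s powr (- \<gamma>)"
    using \<open>0 < \<alpha>\<close> \<open>0 < s\<close> by (simp add: k_def powr_divide powr_add powr_minus field_simps)
  finally show ?thesis .
qed (use assms in auto)

text \<open>Jensen's inequality for \<open>x powr p\<close> at \<open>A / y\<close> and
  \<open>B / z\<close> with weights proportional to \<open>y\<close> and \<open>z\<close>. With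
  \<open>p = 1 + \<gamma>\<close> it minimises the Hopf--Lax expression for linear data.\<close>

lemma powr_sum_ge_powr_sum:
  fixes A B y z p :: real
  assumes "0 < A" "0 < B" "0 < y" "0 < z" "1 \<le> p"
  shows "(A + B) powr p * (y + z) powr (1 - p) \<le> A powr p * y powr (1 - p) + B powr p * z powr (1 - p)"
proof -
  have "convex_on {0<..} (\<lambda>x. x powr p)"
    using assms(5) by (rule powr_convex)
  from convex_onD[OF this, of "z / (y + z)" "A / y" "B / z"] assms
  have "((1 - z / (y + z)) *\<^sub>R (A / y) + (z / (y + z)) *\<^sub>R (B / z)) powr p
      \<le> (1 - z / (y + z)) * (A / y) powr p + (z / (y + z)) * (B / z) powr p"
    by (simp add: field_simps)
  moreover have "1 - z / (y + z) = y / (y + z)"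
    using assms by (simp add: field_simps)
  moreover have "(y / (y + z)) *\<^sub>R (A / y) + (z / (y + z)) *\<^sub>R (B / z) = (A + B) / (y + z)"
    using assms by (simp add: add_divide_distrib)
  ultimately have "((A + B) / (y + z)) powr p
      \<le> y / (y + z) * (A / y) powr p + (z / (y + z)) * (B / z) powr p"
    by simp
  also have "\<dots> = (y * (A / y) powr p + z * (B / z) powr p) / (y + z)"
    by (simp add: add_divide_distrib)
  finally have "(y + z) * ((A + B) / (y + z)) powr p \<le> y * (A / y) powr p + z * (B / z) powr p"
    using assms by (simp add: pos_le_divide_eq mult.commute)
  then show ?thesis
    using assms by (simp add: powr_divide powr_diff field_simps)
qed

section \<open>Classical solutions: differentiability, bounds and positivity\<close>

text \<open>Names the witnesses \<open>m_t\<close> and \<open>m_\<rho>\<close> of the existential in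
  \<open>classical_solution\<close>, so that all later statements speak of the same partial
  derivatives.\<close>

locale mass_solution =
  fixes \<alpha> T :: real and m0 u0 :: "real \<Rightarrow> real" and m m_t m_\<rho> :: "real \<Rightarrow> real \<Rightarrow> real"
  assumes alpha: "0 < \<alpha>" "\<alpha> < 1"
    and m0_zero: "m0 0 = 0"
    and m0_deriv: "\<And>\<rho>. \<rho> \<ge> 0 \<Longrightarrow> (m0 has_real_derivative u0 \<rho>) (at \<rho> within {0..})"
    and u0_nonneg: "\<And>\<rho>. \<rho> \<ge> 0 \<Longrightarrow> u0 \<rho> \<ge> 0"
    and m_cont: "continuous_on ({0..T} \<times> {0..}) (\<lambda>(t, \<rho>). m t \<rho>)"
    and m_init: "\<And>\<rho>. \<rho> \<ge> 0 \<Longrightarrow> m 0 \<rho> = m0 \<rho>"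
    and m_\<rho>_cont: "continuous_on ({0<..T} \<times> {0<..}) (\<lambda>(t, \<rho>). m_\<rho> t \<rho>)"
    and m_t_within: "\<And>t \<rho>. 0 < t \<Longrightarrow> t \<le> T \<Longrightarrow> 0 < \<rho> \<Longrightarrow>
      ((\<lambda>s. m s \<rho>) has_real_derivative m_t t \<rho>) (at t within {0..T})"
    and m_\<rho>_deriv: "\<And>t \<rho>. 0 < t \<Longrightarrow> t \<le> T \<Longrightarrow> 0 < \<rho> \<Longrightarrow>
      ((\<lambda>r. m t r) has_real_derivative m_\<rho> t \<rho>) (at \<rho>)"
    and m_\<rho>_nonneg: "\<And>t \<rho>. 0 < t \<Longrightarrow> t \<le> T \<Longrightarrow> 0 < \<rho> \<Longrightarrow> m_\<rho> t \<rho> \<ge> 0"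
    and m_eq: "\<And>t \<rho>. 0 < t \<Longrightarrow> t \<le> T \<Longrightarrow> 0 < \<rho> \<Longrightarrow> m_t t \<rho> + m t \<rho> * m_\<rho> t \<rho> powr \<alpha> = 0"
begin

text \<open>The exponent with \<open>\<alpha> * (1 + \<gamma>) = \<gamma>\<close>: for
  \<open>v = m powr (- \<gamma>)\<close> both \<open>v\<^sub>t\<close> and
  \<open>(- v\<^sub>\<rho>) powr \<alpha>\<close> are then constant multiples of
  \<open>m powr (- \<gamma>) * m_\<rho> powr \<alpha>\<close>.\<close>

definition \<gamma> :: real where "\<gamma> = \<alpha> / (1 - \<alpha>)"

lemma gamma: "0 < \<gamma>" "(1 + \<gamma>) * (1 - \<alpha>) = 1" "\<alpha> * (1 + \<gamma>) = \<gamma>" "\<gamma> * (1 - \<alpha>) = \<alpha>"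
  using alpha by (auto simp: \<gamma>_def field_simps)

lemma m_t_deriv:
  assumes "0 < t" "t < T" "0 < \<rho>"
  shows "((\<lambda>s. m s \<rho>) has_real_derivative m_t t \<rho>) (at t)"
proof -
  have "((\<lambda>s. m s \<rho>) has_real_derivative m_t t \<rho>) (at t within {0<..<T})"
    using m_t_within[of t \<rho>] assms by (auto intro: has_field_derivative_subset)
  then show ?thesis
    using assms by (simp add: at_within_open[of _ "{0<..<T}"])
qed

text \<open>Provides the chain rule along slanted lines in \<open>hopf_lax_le\<close>.
  Differentiability in time at the point and joint continuity of \<open>m_\<rho>\<close> combine to
  total differentiability.\<close>

lemma m_total_deriv:
  assumes "0 < t" "t < T" "0 < \<rho>"
  shows "((\<lambda>(t, \<rho>). m t \<rho>) has_derivative (\<lambda>(a, b). m_t t \<rho> * a + m_\<rho> t \<rho> * b)) (at (t, \<rho>))"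
proof -
  have "((\<lambda>(x, y). m x y) has_derivative
      (\<lambda>(tx, ty). m_t t \<rho> * tx + blinfun_apply (blinfun_scaleR_right (m_\<rho> t \<rho>)) ty))
      (at (t, \<rho>) within {0<..<T} \<times> {0<..})"
  proof (rule has_derivative_partialsI)
    show "((\<lambda>x. m x \<rho>) has_derivative (*) (m_t t \<rho>)) (at t within {0<..<T})"
      using m_t_deriv[OF assms] unfolding has_field_derivative_def by (rule has_derivative_at_withinI)
    show "(m x has_derivative blinfun_apply (blinfun_scaleR_right (m_\<rho> x y))) (at y within {0<..})"
      if "x \<in> {0<..<T}" "y \<in> {0<..}" for x y
      using has_derivative_at_withinI[OF m_\<rho>_deriv[of x y, unfolded has_field_derivative_def]] that
      by (simp add: real_scaleR_def[abs_def])
    have "continuous_on ({0<..<T} \<times> {0<..}) (\<lambda>p. blinfun_scaleR_right (m_\<rho> (fst p) (snd p)) :: real \<Rightarrow>\<^sub>L real)"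
      by (intro bounded_linear.continuous_on[OF bounded_linear_blinfun_scaleR_right]
          continuous_on_subset[OF m_\<rho>_cont[unfolded case_prod_beta]]) auto
    then show "continuous (at (t, \<rho>) within {0<..<T} \<times> {0<..})
        (\<lambda>(x, y). blinfun_scaleR_right (m_\<rho> x y) :: real \<Rightarrow>\<^sub>L real)"
      unfolding continuous_on_eq_continuous_within case_prod_beta
      by (rule bspec) (use assms in simp)
    show "\<rho> \<in> {0<..}" "convex {0::real<..}"
      using assms by (simp_all add: convex_real_interval)
  qed
  moreover have "at (t, \<rho>) within {0<..<T} \<times> {0<..} = at (t, \<rho>)"
    by (rule at_within_open) (use assms in \<open>auto intro: open_Times\<close>)
  ultimately show ?thesis
    by simp
qed

lemma m_cont_path:
  assumes "continuous_on S f" "continuous_on S g" "\<And>x. x \<in> S \<Longrightarrow> 0 \<le> f x \<and> f x \<le> T \<and> 0 \<le> g x"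
  shows "continuous_on S (\<lambda>x. m (f x) (g x))"
proof -
  have "continuous_on S ((\<lambda>(t, \<rho>). m t \<rho>) \<circ> (\<lambda>x. (f x, g x)))"
    using assms by (intro continuous_on_compose continuous_on_subset[OF m_cont] continuous_intros) auto
  then show ?thesis by (simp add: o_def)
qed

lemma m0_cont: "continuous_on {0..} m0"
  using m0_deriv by (intro DERIV_continuous_on) auto

lemma m0_deriv_at: "0 < \<rho> \<Longrightarrow> (m0 has_real_derivative u0 \<rho>) (at \<rho>)"
  using has_field_derivative_subset[OF m0_deriv[of \<rho>], of "{0<..}"]
  by (simp add: at_within_open[of _ "{0<..}"] subset_eq)

lemma m0_mono:
  assumes "0 \<le> x" "x \<le> y"
  shows "m0 x \<le> m0 y"
proof (rule DERIV_nonneg_imp_increasing_open[OF assms(2)])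
  show "\<exists>z. DERIV m0 w :> z \<and> z \<ge> 0" if "x < w" "w < y" for w
    using m0_deriv_at[of w] u0_nonneg[of w] that assms by auto
  show "continuous_on {x..y} m0"
    using m0_cont assms by (auto elim: continuous_on_subset)
qed

lemma m0_nonneg: "0 \<le> x \<Longrightarrow> 0 \<le> m0 x"
  using m0_mono[of 0 x] m0_zero by simp

text \<open>The square of \<open>m\<close> has time derivative
  \<open>- 2 * m\<^sup>2 * m_\<rho> powr \<alpha>\<close>, which is nonpositive whatever the sign of
  \<open>m\<close>; that sign is not yet known here.\<close>

lemma m_abs_le:
  assumes "0 \<le> t" "t \<le> T" "0 < \<rho>"
  shows "\<bar>m t \<rho>\<bar> \<le> m0 \<rho>"
proof -
  have "(m t \<rho>)\<^sup>2 \<le> (m 0 \<rho>)\<^sup>2"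
  proof (rule DERIV_nonpos_imp_decreasing_open[where f = "\<lambda>s. (m s \<rho>)\<^sup>2"])
    show "\<exists>y. ((\<lambda>s. (m s \<rho>)\<^sup>2) has_real_derivative y) (at s) \<and> y \<le> 0" if "0 < s" "s < t" for s
    proof (intro exI conjI)
      show "((\<lambda>s. (m s \<rho>)\<^sup>2) has_real_derivative 2 * m s \<rho> * m_t s \<rho>) (at s)"
        by (rule derivative_eq_intros m_t_deriv | use that assms in simp)+
      have "2 * m s \<rho> * m_t s \<rho> = - 2 * (m s \<rho>)\<^sup>2 * m_\<rho> s \<rho> powr \<alpha>"
        using m_eq[of s \<rho>] that assms by (simp add: eq_neg_iff_add_eq_0 [symmetric] power2_eq_square)
      then show "2 * m s \<rho> * m_t s \<rho> \<le> 0" by simp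
    qed
    show "continuous_on {0..t} (\<lambda>s. (m s \<rho>)\<^sup>2)"
      by (intro continuous_intros m_cont_path) (use assms in auto)
  qed (use assms in simp)
  then have "\<bar>m t \<rho>\<bar> \<le> \<bar>m 0 \<rho>\<bar>" by (simp add: abs_le_square_iff)
  then show ?thesis using m_init[of \<rho>] m0_nonneg[of \<rho>] assms by simp
qed

text \<open>Gronwall's argument for the linear equation \<open>m_t = - m * q\<close> with
  \<open>q = m_\<rho> powr \<alpha>\<close>. The coefficient is bounded on \<open>{s..t}\<close> by
  compactness; \<open>s\<close> must be positive because \<open>m_\<rho>\<close> is controlled only
  at positive times.\<close>

lemma m_nonzero:
  assumes "0 < t" "t \<le> T" "0 < \<rho>" "0 < s" "s \<le> t" "m s \<rho> \<noteq> 0"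
  shows "m t \<rho> \<noteq> 0"
proof -
  have "continuous_on {s..t} ((\<lambda>(t, \<rho>). m_\<rho> t \<rho>) \<circ> (\<lambda>x. (x, \<rho>)))"
    using assms by (intro continuous_on_compose continuous_on_subset[OF m_\<rho>_cont] continuous_intros) auto
  then have "continuous_on {s..t} (\<lambda>x. m_\<rho> x \<rho> powr \<alpha>)"
    using assms m_\<rho>_nonneg alpha by (intro continuous_on_powr' continuous_intros) (auto simp: o_def)
  then have "bounded ((\<lambda>x. m_\<rho> x \<rho> powr \<alpha>) ` {s..t})"
    by (intro compact_imp_bounded compact_continuous_image) auto
  then obtain M where M: "\<And>x. x \<in> {s..t} \<Longrightarrow> m_\<rho> x \<rho> powr \<alpha> \<le> M"
    unfolding bounded_iff by (metis abs_le_D1 imageI real_norm_def)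
  have "(m s \<rho>)\<^sup>2 * exp (2 * M * s) \<le> (m t \<rho>)\<^sup>2 * exp (2 * M * t)"
  proof (rule DERIV_nonneg_imp_increasing_open[where f = "\<lambda>s. (m s \<rho>)\<^sup>2 * exp (2 * M * s)"])
    show "\<exists>y. ((\<lambda>s. (m s \<rho>)\<^sup>2 * exp (2 * M * s)) has_real_derivative y) (at x) \<and> y \<ge> 0"
      if "s < x" "x < t" for x
    proof (intro exI conjI)
      show "((\<lambda>s. (m s \<rho>)\<^sup>2 * exp (2 * M * s)) has_real_derivative
          (2 * m x \<rho> * m_t x \<rho> + 2 * M * (m x \<rho>)\<^sup>2) * exp (2 * M * x)) (at x)"
        by (rule derivative_eq_intros m_t_deriv refl | use that assms in \<open>simp add: algebra_simps\<close>)+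
      have "2 * m x \<rho> * m_t x \<rho> + 2 * M * (m x \<rho>)\<^sup>2 = 2 * (m x \<rho>)\<^sup>2 * (M - m_\<rho> x \<rho> powr \<alpha>)"
        using m_eq[of x \<rho>] that assms
        by (simp add: eq_neg_iff_add_eq_0 [symmetric] power2_eq_square algebra_simps)
      then show "0 \<le> (2 * m x \<rho> * m_t x \<rho> + 2 * M * (m x \<rho>)\<^sup>2) * exp (2 * M * x)"
        using M[of x] that by simp
    qed
    show "continuous_on {s..t} (\<lambda>s. (m s \<rho>)\<^sup>2 * exp (2 * M * s))"
      by (intro continuous_intros m_cont_path) (use assms in auto)
  qed (use assms in simp)
  with assms show ?thesis
    by (auto simp: mult_le_0_iff)
qed

lemma m_pos:
  assumes "0 \<le> t" "t \<le> T" "0 < \<rho>" "0 < m0 \<rho>"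
  shows "0 < m t \<rho>"
proof (rule ccontr)
  assume neg: "\<not> 0 < m t \<rho>"
  have cont: "continuous_on {0..t} (\<lambda>s. m s \<rho>)"
    by (intro continuous_intros m_cont_path) (use assms in auto)
  have init: "m 0 \<rho> = m0 \<rho>" using m_init assms by simp
  \<comment> \<open>Half the initial value is attained at a positive time, from which
    \<open>m_nonzero\<close> can start.\<close>
  have "\<exists>s\<ge>0. s \<le> t \<and> m s \<rho> = m0 \<rho> / 2"
    by (rule IVT2') (use neg assms init cont in auto)
  then obtain s where s: "0 \<le> s" "s \<le> t" "m s \<rho> = m0 \<rho> / 2" by blast
  have "s \<noteq> 0" using s init assms by auto
  have "\<exists>r\<ge>s. r \<le> t \<and> m r \<rho> = 0"
    by (rule IVT2') (use neg assms s cont in \<open>auto elim: continuous_on_subset\<close>)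
  then obtain r where r: "s \<le> r" "r \<le> t" "m r \<rho> = 0" by blast
  show False
    using m_nonzero[of r \<rho> s] r s \<open>s \<noteq> 0\<close> assms by auto
qed

lemma m_nonneg_le:
  assumes "0 \<le> t" "t \<le> T" "0 < \<rho>"
  shows "0 \<le> m t \<rho> \<and> m t \<rho> \<le> m0 \<rho>"
  using m_abs_le[OF assms] m_pos[OF assms] m0_nonneg[of \<rho>] assms by fastforce

text \<open>The equation is only posed for \<rho> > 0; the boundary value comes from continuity and
  the squeeze between 0 and \<open>m0\<close>.\<close>

lemma m_at_zero:
  assumes "0 \<le> t" "t \<le> T"
  shows "m t 0 = 0"
proof -
  have lim0: "(m0 \<longlongrightarrow> 0) (at_right 0)"
    using m0_cont m0_zero by (auto simp: continuous_on_def at_within_Ici_at_right dest: bspec[of _ _ 0])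
  have "continuous_on {0..} (m t)"
    by (intro m_cont_path continuous_intros) (use assms in auto)
  then have "(m t \<longlongrightarrow> m t 0) (at_right 0)"
    by (auto simp: continuous_on_def at_within_Ici_at_right dest: bspec[of _ _ 0])
  moreover have "(m t \<longlongrightarrow> 0) (at_right 0)"
  proof (rule real_tendsto_sandwich[OF _ _ tendsto_const lim0])
    show "\<forall>\<^sub>F x in at_right 0. 0 \<le> m t x" "\<forall>\<^sub>F x in at_right 0. m t x \<le> m0 x"
      using m_nonneg_le assms by (auto simp: eventually_at_filter)
  qed
  ultimately show ?thesis
    using tendsto_unique trivial_limit_at_right_real by blast
qed

section \<open>The Hopf--Lax formula\<close>

text \<open>Along the segment from \<open>(0, y)\<close> to \<open>(t, x)\<close> of speed
  \<open>s\<close>, the function \<open>m powr (- \<gamma>)\<close> grows at rate \<open>\<gamma> *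
  m powr (- \<gamma>) * (q powr \<alpha> - (s / m) * q)\<close> with \<open>q = m_\<rho>\<close>. By
  \<open>powr_legendre_bound\<close> this is at most the constant \<open>L\<close>, and
  \<open>L * t\<close> is the second summand.\<close>

lemma hopf_lax_le:
  assumes "0 < t" "t \<le> T" "0 < y" "y < x" "0 < m0 y"
  shows "m t x powr (- \<gamma>) \<le> m0 y powr (- \<gamma>) + (\<alpha> * t) powr (1 + \<gamma>) * (x - y) powr (- \<gamma>)"
proof -
  define s where "s = (x - y) / t"
  define L where "L = \<alpha> powr (1 + \<gamma>) * s powr (- \<gamma>)"
  have s: "s > 0" using assms by (simp add: s_def)
  define h where "h = (\<lambda>\<tau>. m \<tau> (y + s * \<tau>) powr (- \<gamma>) - L * \<tau>)"
  have pos: "0 < m \<tau> (y + s * \<tau>)" if "0 \<le> \<tau>" "\<tau> \<le> t" for \<tau>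
  proof (rule m_pos)
    show "0 < y + s * \<tau>" using s assms that by (simp add: add_pos_nonneg)
    show "0 < m0 (y + s * \<tau>)" using m0_mono[of y "y + s * \<tau>"] s assms that by simp
  qed (use assms that in auto)
  have "h t \<le> h 0"
  proof (rule DERIV_nonpos_imp_decreasing_open[where f = h])
    show "\<exists>z. DERIV h \<tau> :> z \<and> z \<le> 0" if \<tau>: "0 < \<tau>" "\<tau> < t" for \<tau>
    proof (intro exI conjI)
      let ?\<rho> = "y + s * \<tau>"
      have \<rho>: "0 < ?\<rho>" using s assms that by (simp add: add_pos_nonneg)
      have "((\<lambda>r. (r, y + s * r)) has_derivative (\<lambda>r. (r, s * r))) (at \<tau>)"
        by (auto intro!: derivative_eq_intros)
      from has_derivative_compose[OF this m_total_deriv[of \<tau> ?\<rho>]] \<tau> \<rho> assms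
      have d: "((\<lambda>r. m r (y + s * r)) has_real_derivative m_t \<tau> ?\<rho> + s * m_\<rho> \<tau> ?\<rho>) (at \<tau>)"
        unfolding has_field_derivative_def
        by (auto elim!: has_derivative_eq_rhs simp: algebra_simps)
      show "DERIV h \<tau> :> - \<gamma> * m \<tau> ?\<rho> powr (- \<gamma> - 1) * (m_t \<tau> ?\<rho> + s * m_\<rho> \<tau> ?\<rho>) - L"
        unfolding h_def
        by (rule derivative_eq_intros d DERIV_fun_powr refl | use pos[of \<tau>] \<tau> in simp)+
      have mt: "m_t \<tau> ?\<rho> = - (m \<tau> ?\<rho> * m_\<rho> \<tau> ?\<rho> powr \<alpha>)"
        using m_eq[of \<tau> ?\<rho>] \<tau> \<rho> assms by simp
      have "\<gamma> * (m_\<rho> \<tau> ?\<rho> powr \<alpha> - (s / m \<tau> ?\<rho>) * m_\<rho> \<tau> ?\<rho>)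
          \<le> \<alpha> powr (1 + \<gamma>) * (s / m \<tau> ?\<rho>) powr (- \<gamma>)"
        unfolding \<gamma>_def
        by (rule powr_legendre_bound) (use pos[of \<tau>] \<tau> \<rho> s alpha assms m_\<rho>_nonneg in auto)
      \<comment> \<open>The factor \<open>m powr (- \<gamma>)\<close> cancels the dependence of the
        Legendre bound on \<open>m\<close>.\<close>
      then have "m \<tau> ?\<rho> powr (- \<gamma>) * (\<gamma> * (m_\<rho> \<tau> ?\<rho> powr \<alpha> - (s / m \<tau> ?\<rho>) * m_\<rho> \<tau> ?\<rho>))
          \<le> m \<tau> ?\<rho> powr (- \<gamma>) * (\<alpha> powr (1 + \<gamma>) * (s / m \<tau> ?\<rho>) powr (- \<gamma>))"
        by (rule mult_left_mono) simp
      also have "\<dots> = L"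
        using pos[of \<tau>] \<tau> s by (simp add: L_def powr_divide)
      finally show "- \<gamma> * m \<tau> ?\<rho> powr (- \<gamma> - 1) * (m_t \<tau> ?\<rho> + s * m_\<rho> \<tau> ?\<rho>) - L \<le> 0"
        using pos[of \<tau>] \<tau> unfolding mt by (simp add: powr_diff field_simps)
    qed
    show "continuous_on {0..t} h"
      unfolding h_def
    proof (intro ballI continuous_intros continuous_on_powr m_cont_path)
      show "m \<tau> (y + s * \<tau>) \<noteq> 0" if "\<tau> \<in> {0..t}" for \<tau>
        using pos[of \<tau>] that by auto
    qed (use assms s in auto)
  qed (use assms in simp)
  moreover have "L * t = (\<alpha> * t) powr (1 + \<gamma>) * (x - y) powr (- \<gamma>)"
    using assms alpha by (simp add: L_def s_def powr_mult powr_divide powr_add powr_minus field_simps)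
  ultimately show ?thesis
    using assms m_init[of y] by (simp add: h_def s_def)
qed

lemma powr_neg_gamma_le_iff:
  assumes "0 < a" "0 < b"
  shows "a powr (- \<gamma>) \<le> b powr (- \<gamma>) \<longleftrightarrow> b \<le> a"
proof
  assume le: "a powr (- \<gamma>) \<le> b powr (- \<gamma>)"
  show "b \<le> a"
  proof (rule ccontr)
    assume "\<not> b \<le> a"
    then have "b powr (- \<gamma>) < a powr (- \<gamma>)"
      using powr_less_mono2_neg[of "- \<gamma>" a b] gamma assms by auto
    with le show False by simp
  qed
next
  assume "b \<le> a"
  then show "a powr (- \<gamma>) \<le> b powr (- \<gamma>)"
    using powr_mono2'[of "- \<gamma>" b a] gamma assms by auto
qed

text \<open>Makes the Hopf--Lax expression large at both ends: on the left \<open>z\<close> is a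
  value of the mass, on the right it is the distance to \<open>x\<close>.\<close>

lemma powr_neg_gamma_blowup:
  obtains \<eta> where "0 < \<eta>" "\<And>z. 0 < z \<Longrightarrow> z \<le> \<eta> \<Longrightarrow> K < z powr (- \<gamma>)"
proof
  define \<eta> where "\<eta> = (\<bar>K\<bar> + 1) powr (- 1 / \<gamma>)"
  show \<eta>: "0 < \<eta>" by (simp add: \<eta>_def add_nonneg_eq_0_iff)
  have "\<eta> powr (- \<gamma>) = \<bar>K\<bar> + 1"
    using gamma by (simp add: \<eta>_def powr_powr)
  then show "K < z powr (- \<gamma>)" if "0 < z" "z \<le> \<eta>" for z
    using powr_neg_gamma_le_iff[OF \<eta> \<open>0 < z\<close>] that by linarith
qed

text \<open>Since \<open>m0\<close> may vanish on an initial interval, the left end is located by a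
  small positive value of \<open>m0\<close>, not by closeness to 0.\<close>

lemma m0_small_left:
  assumes "0 \<le> c" "0 < m0 c" "0 < \<eta>"
  obtains a where "0 < a" "a < c" "0 < m0 a" "m0 a < \<eta>"
proof -
  define w where "w = min (m0 c) \<eta> / 2"
  have w: "0 < w" "w < m0 c" "w < \<eta>"
    using assms by (auto simp: w_def)
  have "\<exists>a\<ge>0. a \<le> c \<and> m0 a = w"
    by (rule IVT') (use w assms m0_zero m0_cont in \<open>auto elim: continuous_on_subset\<close>)
  then obtain a where a: "0 \<le> a" "a \<le> c" "m0 a = w" by blast
  moreover have "a \<noteq> 0" "a \<noteq> c" using a w m0_zero by auto
  ultimately show thesis using that[of a] w by simp
qed

text \<open>
  The second summand below has the opposite \<open>\<rho>\<close>-slope and solves the time-reversed equation, so that at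
  a point where the \<open>\<rho>\<close>-derivatives cancel the time derivatives cancel as well: the sum has
  no interior minimum once it is tilted by \<open>\<epsilon> * \<tau>\<close>.
\<close>

lemma barrier_minimum_principle:
  fixes t x :: real
  defines "G \<equiv> \<lambda>\<tau> y. m \<tau> y powr (- \<gamma>) + (\<alpha> * (t - \<tau>)) powr (1 + \<gamma>) * (x - y) powr (- \<gamma>)"
  assumes t: "0 \<le> t1" "t1 < t" "t \<le> T" and ab: "0 < a" "b < x" "0 < m0 a"
    and sides: "\<And>\<tau>. 0 \<le> \<tau> \<Longrightarrow> \<tau> \<le> t1 \<Longrightarrow> N \<le> G \<tau> a \<and> N \<le> G \<tau> b"
    and bottom: "\<And>y. a \<le> y \<Longrightarrow> y \<le> b \<Longrightarrow> N \<le> G 0 y"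
    and "0 \<le> \<tau>0" "\<tau>0 \<le> t1" "a \<le> y0" "y0 \<le> b"
  shows "N \<le> G \<tau>0 y0"
proof (rule ccontr)
  assume "\<not> N \<le> G \<tau>0 y0"
  then have less: "G \<tau>0 y0 < N" by simp
  \<comment> \<open>Small enough that the tilt, at most \<open>\<epsilon> * t1\<close> on the
    rectangle, keeps the minimum of \<open>H\<close> below \<open>N\<close>.\<close>
  define \<epsilon> where "\<epsilon> = (N - G \<tau>0 y0) / (t1 + 1)"
  have \<epsilon>: "0 < \<epsilon>" "G \<tau>0 y0 + \<epsilon> * t1 < N"
    using less t by (auto simp: \<epsilon>_def field_simps)
  define H where "H = (\<lambda>\<tau> y. G \<tau> y + \<epsilon> * \<tau>)"
  define K where "K = {0..t1} \<times> {a..b}"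
  have pos: "0 < m \<tau> y" if "0 \<le> \<tau>" "\<tau> \<le> t1" "a \<le> y" for \<tau> y
    using m_pos[of \<tau> y] m0_mono[of a y] that t ab by simp
  have cont: "continuous_on K (\<lambda>p. H (fst p) (snd p))"
    unfolding H_def G_def
  proof (intro ballI continuous_intros continuous_on_powr m_cont_path)
    fix p assume "p \<in> K"
    then show "m (fst p) (snd p) \<noteq> 0" "x - snd p \<noteq> 0" "\<alpha> * (t - fst p) \<noteq> 0"
        "0 \<le> fst p \<and> fst p \<le> T \<and> 0 \<le> snd p"
      using pos[of "fst p" "snd p"] t ab alpha by (auto simp: K_def)
  qed
  have "compact K" "(\<tau>0, y0) \<in> K"
    using assms by (auto simp: K_def intro: compact_Times)
  then obtain p where p: "p \<in> K" "\<And>q. q \<in> K \<Longrightarrow> H (fst p) (snd p) \<le> H (fst q) (snd q)"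
    using continuous_attains_inf[OF _ _ cont] by blast
  obtain \<tau> y where "p = (\<tau>, y)" by (cases p)
  then have \<tau>y: "0 \<le> \<tau>" "\<tau> \<le> t1" "a \<le> y" "y \<le> b"
    and min: "\<And>\<sigma> z. 0 \<le> \<sigma> \<Longrightarrow> \<sigma> \<le> t1 \<Longrightarrow> a \<le> z \<Longrightarrow> z \<le> b \<Longrightarrow> H \<tau> y \<le> H \<sigma> z"
    using p by (auto simp: K_def)
  have "H \<tau> y \<le> H \<tau>0 y0"
    using assms by (intro min) auto
  also have "\<dots> \<le> G \<tau>0 y0 + \<epsilon> * t1"
    using \<epsilon> assms by (auto simp: H_def)
  finally have "H \<tau> y < N" using \<epsilon> by simp
  then have "G \<tau> y < N"
    using \<epsilon> \<tau>y by (smt (verit) H_def mult_nonneg_nonneg)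
  \<comment> \<open>The minimum may still lie at the final time \<open>t1\<close>, so the
    contradiction will only look at earlier times.\<close>
  then have interior: "0 < \<tau>" "a < y" "y < b"
    using sides[of \<tau>] bottom[of y] \<tau>y by (auto simp: less_le)
  have y: "0 < y" "y < x" and \<tau>: "\<tau> < t" "\<tau> < T"
    using interior \<tau>y t ab by auto
  have neg_eq: "- (1 + \<gamma>) = - \<gamma> - 1" by simp
  have d_pos: "0 < min (y - a) (b - y)" using interior by simp
  have mpos: "0 < m \<tau> y" using pos \<tau>y by simp
  define A where "A = \<alpha> * (t - \<tau>)"
  define d where "d = x - y"
  have Ad: "0 < A" "0 < d" using alpha \<tau> y by (auto simp: A_def d_def)
  have "((\<lambda>z. H \<tau> z) has_real_derivative
      - \<gamma> * m \<tau> y powr (- \<gamma> - 1) * m_\<rho> \<tau> y + A powr (1 + \<gamma>) * (\<gamma> * d powr (- \<gamma> - 1))) (at y)"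
    unfolding H_def G_def A_def d_def
    by (rule derivative_eq_intros DERIV_fun_powr m_\<rho>_deriv refl
        | use mpos y \<tau> interior t in \<open>simp add: algebra_simps\<close>)+
  moreover have "\<forall>z. \<bar>y - z\<bar> < min (y - a) (b - y) \<longrightarrow> H \<tau> y \<le> H \<tau> z"
    using \<tau>y by (auto intro!: min)
  ultimately have "- \<gamma> * m \<tau> y powr (- \<gamma> - 1) * m_\<rho> \<tau> y + A powr (1 + \<gamma>) * (\<gamma> * d powr (- \<gamma> - 1)) = 0"
    by (rule DERIV_local_min[where d = "min (y - a) (b - y)", OF _ d_pos])
  then have "\<gamma> * (m \<tau> y powr (- \<gamma> - 1) * m_\<rho> \<tau> y) = \<gamma> * (A powr (1 + \<gamma>) * d powr (- \<gamma> - 1))"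
    by (auto simp: algebra_simps)
  then have "m \<tau> y powr (- (1 + \<gamma>)) * m_\<rho> \<tau> y = A powr (1 + \<gamma>) * d powr (- (1 + \<gamma>))"
    unfolding neg_eq using gamma by simp
  \<comment> \<open>The vanishing \<open>y\<close>-derivative determines \<open>m_\<rho>\<close>,
    and the equation then determines \<open>m_t\<close>.\<close>
  then have "m_\<rho> \<tau> y = (m \<tau> y * A / d) powr (1 + \<gamma>)"
    using mpos Ad by (simp only: powr_minus) (simp add: powr_mult powr_divide field_simps)
  then have "m_\<rho> \<tau> y powr \<alpha> = (m \<tau> y * A / d) powr \<gamma>"
    using gamma by (simp add: powr_powr mult.commute)
  then have mt: "m_t \<tau> y = - (m \<tau> y * (m \<tau> y * A / d) powr \<gamma>)"
    using m_eq[of \<tau> y] \<tau> y interior by simp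
  have "((\<lambda>\<sigma>. H \<sigma> y) has_real_derivative
      - \<gamma> * m \<tau> y powr (- \<gamma> - 1) * m_t \<tau> y - (1 + \<gamma>) * A powr \<gamma> * \<alpha> * d powr (- \<gamma>) + \<epsilon>) (at \<tau>)"
    unfolding H_def G_def A_def d_def
    by (rule derivative_eq_intros DERIV_fun_powr m_t_deriv refl
        | use mpos y \<tau> interior alpha in \<open>simp add: algebra_simps\<close>)+
  moreover have "- \<gamma> * m \<tau> y powr (- \<gamma> - 1) * m_t \<tau> y = \<gamma> * (A powr \<gamma> * d powr (- \<gamma>))"
    using mpos Ad by (simp add: mt powr_mult powr_divide powr_minus powr_diff field_simps)
  moreover have "(1 + \<gamma>) * A powr \<gamma> * \<alpha> * d powr (- \<gamma>) = \<gamma> * (A powr \<gamma> * d powr (- \<gamma>))"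
    using gamma(3) by (metis (no_types) mult.assoc mult.commute)
  \<comment> \<open>The time derivatives of the two summands of \<open>G\<close> cancel and only the
    tilt remains; hence \<open>H\<close> is smaller slightly earlier.\<close>
  ultimately have "((\<lambda>\<sigma>. H \<sigma> y) has_real_derivative \<epsilon>) (at \<tau>)"
    by simp
  from DERIV_pos_inc_left[OF this \<epsilon>(1)]
  obtain e where e: "e > 0" "\<And>h. 0 < h \<Longrightarrow> h < e \<Longrightarrow> H (\<tau> - h) y < H \<tau> y" by blast
  define h where "h = min e \<tau> / 2"
  have "H (\<tau> - h) y < H \<tau> y" using e interior by (auto simp: h_def)
  moreover have "H \<tau> y \<le> H (\<tau> - h) y"
    using \<tau>y e interior by (intro min) (auto simp: h_def min_def)
  ultimately show False by simp
qed

text \<open>The barrier degenerates at \<open>(t, x)\<close>, so that point is approached diagonally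
  through \<open>(t - \<delta>, x - \<delta>)\<close>. There the second summand equals
  \<open>\<alpha> powr (1 + \<gamma>) * \<delta>\<close>, which tends to 0.\<close>

lemma hopf_lax_ge:
  assumes t: "0 < t" "t \<le> T" and x: "0 < x" "0 < m0 x"
    and M: "\<And>y. 0 < y \<Longrightarrow> y < x \<Longrightarrow> 0 < m0 y \<Longrightarrow>
      M \<le> m0 y powr (- \<gamma>) + (\<alpha> * t) powr (1 + \<gamma>) * (x - y) powr (- \<gamma>)"
  shows "M \<le> m t x powr (- \<gamma>)"
proof -
  define F where "F = (\<lambda>\<delta>. m (t - \<delta>) (x - \<delta>) powr (- \<gamma>) + \<alpha> powr (1 + \<gamma>) * \<delta>)"
  obtain c where c: "0 < c" "c < x" "0 < m0 c"
    using m0_small_left[of x 1] x by auto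
  define D where "D = min t (x - c)"
  have D: "0 < D" using t c by (simp add: D_def)
  have ev: "M \<le> F \<delta>" if \<delta>: "0 < \<delta>" "\<delta> < D" for \<delta>
  proof -
    let ?G = "\<lambda>\<tau> y. m \<tau> y powr (- \<gamma>) + (\<alpha> * (t - \<tau>)) powr (1 + \<gamma>) * (x - y) powr (- \<gamma>)"
    have \<delta>': "\<delta> < t" "c < x - \<delta>" using \<delta> by (auto simp: D_def)
    obtain \<eta> where \<eta>: "0 < \<eta>" "\<And>z. 0 < z \<Longrightarrow> z \<le> \<eta> \<Longrightarrow> M < z powr (- \<gamma>)"
      using powr_neg_gamma_blowup by blast
    \<comment> \<open>At \<open>a\<close> the first summand alone exceeds \<open>M\<close> at all
      times, because \<open>m \<le> m0\<close>.\<close>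
    obtain a where a: "0 < a" "a < c" "0 < m0 a" "m0 a < \<eta>"
      using m0_small_left[of c \<eta>] c \<eta> by auto
    \<comment> \<open>The least coefficient of the second summand over times up to
      \<open>t - \<delta>\<close>; with it that summand alone exceeds \<open>M\<close> at
      \<open>b\<close>.\<close>
    define k where "k = (\<alpha> * \<delta>) powr (1 + \<gamma>)"
    have k: "0 < k" using alpha \<delta> by (simp add: k_def)
    obtain \<eta>' where \<eta>': "0 < \<eta>'" "\<And>z. 0 < z \<Longrightarrow> z \<le> \<eta>' \<Longrightarrow> M / k < z powr (- \<gamma>)"
      using powr_neg_gamma_blowup by blast
    \<comment> \<open>The bound \<open>\<delta> / 2\<close> keeps \<open>x - \<delta>\<close> to the
      left of \<open>b\<close>, inside the rectangle.\<close>
    define b where "b = x - min \<eta>' (\<delta> / 2)"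
    have b: "b < x" "x - \<delta> < b" "x - b \<le> \<eta>'" using \<eta>' \<delta> by (auto simp: b_def)
    have "M \<le> ?G (t - \<delta>) (x - \<delta>)"
    proof (rule barrier_minimum_principle[where ?t1.0 = "t - \<delta>" and a = a and b = b])
      fix \<tau> assume \<tau>: "0 \<le> \<tau>" "\<tau> \<le> t - \<delta>"
      have "M < m \<tau> a powr (- \<gamma>)"
        using m_pos[of \<tau> a] m_nonneg_le[of \<tau> a] \<tau> \<delta> a t by (intro \<eta>) auto
      moreover have "M < k * (x - b) powr (- \<gamma>)"
        using \<eta>'(2)[of "x - b"] b k by (simp add: field_simps)
      moreover have "k * (x - b) powr (- \<gamma>) \<le> (\<alpha> * (t - \<tau>)) powr (1 + \<gamma>) * (x - b) powr (- \<gamma>)"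
        unfolding k_def using \<tau> \<delta> alpha gamma by (intro mult_right_mono powr_mono2) auto
      ultimately show "M \<le> ?G \<tau> a \<and> M \<le> ?G \<tau> b"
        by (smt (verit) mult_nonneg_nonneg powr_ge_zero)
    next
      fix y assume "a \<le> y" "y \<le> b"
      then show "M \<le> ?G 0 y"
        using M[of y] m0_mono[of a y] a b m_init[of y] by simp
    qed (use \<delta> \<delta>' t a b c in auto)
    also have "\<dots> = F \<delta>"
      using \<delta> alpha by (simp add: F_def powr_mult powr_add powr_minus field_simps)
    finally show ?thesis .
  qed
  have "continuous_on {0..D / 2} F"
    unfolding F_def
  proof (intro ballI continuous_intros continuous_on_powr m_cont_path)
    fix \<delta> assume "\<delta> \<in> {0..D / 2}"
    then have \<delta>: "0 \<le> \<delta>" "\<delta> < D" using D by auto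
    then have \<delta>: "0 \<le> \<delta>" "\<delta> < t" "c < x - \<delta>" by (auto simp: D_def)
    then show "0 \<le> t - \<delta> \<and> t - \<delta> \<le> T \<and> 0 \<le> x - \<delta>" using t c by auto
    show "m (t - \<delta>) (x - \<delta>) \<noteq> 0"
      using m_pos[of "t - \<delta>" "x - \<delta>"] m0_mono[of c "x - \<delta>"] \<delta> t c by auto
  qed
  then have "(F \<longlongrightarrow> F 0) (at_right 0)"
    using D by (auto simp: continuous_on_def at_within_Icc_at_right dest: bspec[of _ _ 0])
  moreover have "\<forall>\<^sub>F \<delta> in at_right 0. M \<le> F \<delta>"
    using eventually_at_right_less[of 0] eventually_at_right_real[OF D] by eventually_elim (auto intro: ev)
  ultimately have "M \<le> F 0"
    by (intro tendsto_lowerbound) auto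
  then show ?thesis by (simp add: F_def)
qed

text \<open>Blow-up at both ends confines the minimisation to a compact interval, where a minimiser
  exists and is interior. Its first-order condition is the equation of the characteristic through
  \<open>(t, x)\<close> and forces \<open>u0 y\<close> to be positive.\<close>

lemma hopf_lax_minimizer:
  assumes t: "0 < t" "t \<le> T" and x: "0 < x" "0 < m0 x"
  obtains y where "0 < y" "y < x" "0 < m0 y" "0 < u0 y"
    "x = y + \<alpha> * m0 y * u0 y powr (\<alpha> - 1) * t"
    "m t x powr (- \<gamma>) = m0 y powr (- \<gamma>) + (\<alpha> * t) powr (1 + \<gamma>) * (x - y) powr (- \<gamma>)"
proof -
  define A where "A = \<alpha> * t"
  define g where "g = (\<lambda>y. m0 y powr (- \<gamma>) + A powr (1 + \<gamma>) * (x - y) powr (- \<gamma>))"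
  have A: "0 < A" using alpha t by (simp add: A_def)
  obtain c where c: "0 < c" "c < x" "0 < m0 c"
    using m0_small_left[of x 1] x by auto
  obtain \<eta> where \<eta>: "0 < \<eta>" "\<And>z. 0 < z \<Longrightarrow> z \<le> \<eta> \<Longrightarrow> g c < z powr (- \<gamma>)"
    using powr_neg_gamma_blowup by blast
  obtain a where a: "0 < a" "a < c" "0 < m0 a" "m0 a < \<eta>"
    using m0_small_left[of c \<eta>] c \<eta> by auto
  obtain \<eta>' where \<eta>': "0 < \<eta>'" "\<And>z. 0 < z \<Longrightarrow> z \<le> \<eta>' \<Longrightarrow> g c / A powr (1 + \<gamma>) < z powr (- \<gamma>)"
    using powr_neg_gamma_blowup by blast
  \<comment> \<open>The bound \<open>(x - c) / 2\<close> leaves the competitor \<open>c\<close>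
    inside the interval, so that \<open>g c\<close> bounds the minimum from above.\<close>
  define b where "b = x - min \<eta>' ((x - c) / 2)"
  have b: "b < x" "c < b" "x - b \<le> \<eta>'" using \<eta>' c by (auto simp: b_def min_def field_simps)
  have left: "g c < g y" if "0 < m0 y" "0 < y" "y \<le> a" for y
  proof -
    have "g c < m0 y powr (- \<gamma>)"
      using m0_mono[of y a] that a by (intro \<eta>) auto
    then show ?thesis unfolding g_def by (smt (verit) mult_nonneg_nonneg powr_ge_zero)
  qed
  have right: "g c < g y" if "b \<le> y" "y < x" for y
  proof -
    have "g c < A powr (1 + \<gamma>) * (x - y) powr (- \<gamma>)"
      using \<eta>'(2)[of "x - y"] that A b by (simp add: field_simps)
    then show ?thesis unfolding g_def by (smt (verit) powr_ge_zero)
  qed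
  have "continuous_on {a..b} g"
    unfolding g_def
  proof (intro ballI continuous_intros continuous_on_powr)
    show "continuous_on {a..b} m0"
      using m0_cont a by (auto elim: continuous_on_subset)
    fix y assume "y \<in> {a..b}"
    then show "m0 y \<noteq> 0" "x - y \<noteq> 0" using m0_mono[of a y] a b by auto
  qed
  then obtain y where y: "a \<le> y" "y \<le> b" "\<And>z. a \<le> z \<Longrightarrow> z \<le> b \<Longrightarrow> g y \<le> g z"
    using continuous_attains_inf[of "{a..b}" g] a b by auto
  have gy: "g y \<le> g c" using y a b by simp
  have yab: "a < y" "y < b"
    using left[of a] right[of b] gy a b y(1,2) by (metis less_le not_le order_refl)+
  have neg_eq: "- (1 + \<gamma>) = - \<gamma> - 1" by simp
  have d_pos: "0 < min (y - a) (b - y)" using yab by simp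
  have y0: "0 < y" "y < x" "0 < m0 y"
    using yab a b m0_mono[of a y] by auto
  have "(g has_real_derivative
      - \<gamma> * m0 y powr (- \<gamma> - 1) * u0 y + A powr (1 + \<gamma>) * (\<gamma> * (x - y) powr (- \<gamma> - 1))) (at y)"
    unfolding g_def
    by (rule derivative_eq_intros DERIV_fun_powr m0_deriv_at refl
        | use y0 in \<open>simp add: algebra_simps\<close>)+
  moreover have "\<forall>z. \<bar>y - z\<bar> < min (y - a) (b - y) \<longrightarrow> g y \<le> g z"
    by (auto intro!: y)
  ultimately have "- \<gamma> * m0 y powr (- \<gamma> - 1) * u0 y + A powr (1 + \<gamma>) * (\<gamma> * (x - y) powr (- \<gamma> - 1)) = 0"
    by (rule DERIV_local_min[where d = "min (y - a) (b - y)", OF _ d_pos])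
  then have "\<gamma> * (m0 y powr (- \<gamma> - 1) * u0 y) = \<gamma> * (A powr (1 + \<gamma>) * (x - y) powr (- \<gamma> - 1))"
    by (auto simp: algebra_simps)
  then have "m0 y powr (- (1 + \<gamma>)) * u0 y = A powr (1 + \<gamma>) * (x - y) powr (- (1 + \<gamma>))"
    unfolding neg_eq using gamma by simp
  then have u: "u0 y = (m0 y * A / (x - y)) powr (1 + \<gamma>)"
    using y0 A by (simp only: powr_minus) (simp add: powr_mult powr_divide field_simps)
  \<comment> \<open>Raising to the power \<open>\<alpha> - 1\<close> inverts the first-order
    condition and makes it linear in \<open>x - y\<close>.\<close>
  have "(1 + \<gamma>) * (\<alpha> - 1) = - 1" using gamma(2) by (simp add: algebra_simps)
  then have "u0 y powr (\<alpha> - 1) = (m0 y * A / (x - y)) powr (- 1)"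
    by (simp add: u powr_powr)
  then have "u0 y powr (\<alpha> - 1) = (x - y) / (m0 y * A)"
    using y0 A by (simp add: powr_minus field_simps)
  then have "m0 y * A * u0 y powr (\<alpha> - 1) = x - y"
    using y0 A by simp
  then have char: "x = y + \<alpha> * m0 y * u0 y powr (\<alpha> - 1) * t"
    by (simp add: A_def algebra_simps)
  have "g y \<le> m t x powr (- \<gamma>)"
  proof (rule hopf_lax_ge[OF t x])
    fix z assume z: "0 < z" "z < x" "0 < m0 z"
    \<comment> \<open>Outside \<open>{a..b}\<close>, \<open>left\<close> and \<open>right\<close>
      give values above \<open>g c\<close>, so the minimum is global.\<close>
    have "g y \<le> g z"
      using y(3)[of z] left[of z] right[of z] gy z by linarith
    then show "g y \<le> m0 z powr (- \<gamma>) + (\<alpha> * t) powr (1 + \<gamma>) * (x - z) powr (- \<gamma>)"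
      by (simp add: g_def A_def)
  qed
  moreover have "m t x powr (- \<gamma>) \<le> g y"
    using hopf_lax_le[of t y x] t y0 by (simp add: g_def A_def)
  ultimately have eq: "m t x powr (- \<gamma>) = g y" by simp
  have "0 < u0 y"
    unfolding u using y0 A by simp
  from that[OF y0 this char] eq show thesis
    by (simp add: g_def A_def)
qed

section \<open>Evaluation at the end of a minimising characteristic\<close>

text \<open>The Hopf--Lax competitor evaluated where its own characteristic ends; the exponents
  collapse by \<open>(\<alpha> - 1) * (- \<gamma>) = \<alpha>\<close>. It serves the actual data as
  well as linear data with \<open>M = p * y\<close> and \<open>u = p\<close>.\<close>

lemma kernel_along_characteristic:
  assumes "0 < t" "0 < M" "0 < u"
  shows "M powr (- \<gamma>) + (\<alpha> * t) powr (1 + \<gamma>) * (\<alpha> * M * u powr (\<alpha> - 1) * t) powr (- \<gamma>)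
    = M powr (- \<gamma>) * (1 + \<alpha> * u powr \<alpha> * t)"
proof -
  have A: "0 < \<alpha> * t" using alpha assms by simp
  have "(\<alpha> - 1) * (- \<gamma>) = \<alpha>" using gamma(4) by (simp add: algebra_simps)
  then have "(\<alpha> * t * (M * u powr (\<alpha> - 1))) powr (- \<gamma>) = (\<alpha> * t) powr (- \<gamma>) * (M powr (- \<gamma>) * u powr \<alpha>)"
    using A assms by (simp add: powr_mult powr_powr)
  moreover have "(\<alpha> * t) powr (1 + \<gamma>) * (\<alpha> * t) powr (- \<gamma>) = \<alpha> * t"
    using A by (simp flip: powr_add)
  ultimately have "(\<alpha> * t) powr (1 + \<gamma>) * (\<alpha> * t * (M * u powr (\<alpha> - 1))) powr (- \<gamma>)
      = \<alpha> * t * (M powr (- \<gamma>) * u powr \<alpha>)"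
    by (simp only: mult.assoc [symmetric])
  moreover have "\<alpha> * M * u powr (\<alpha> - 1) * t = \<alpha> * t * (M * u powr (\<alpha> - 1))"
    by simp
  ultimately show ?thesis
    by (simp only:) (simp add: algebra_simps)
qed

context
  fixes t x y :: real
  assumes t: "0 < t" "t \<le> T"
    and y: "0 < y" "0 < m0 y" "0 < u0 y"
    and x: "x = y + \<alpha> * m0 y * u0 y powr (\<alpha> - 1) * t"
    and eq: "m t x powr (- \<gamma>) = m0 y powr (- \<gamma>) + (\<alpha> * t) powr (1 + \<gamma>) * (x - y) powr (- \<gamma>)"
begin

lemma y_less_x: "y < x"
  using x alpha t y by simp

lemma m_x_pos: "0 < m t x"
  using m_pos[of t x] m0_mono[of y x] y_less_x t y by simp

lemma one_plus_pos: "0 < 1 + \<alpha> * u0 y powr \<alpha> * t"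
  using alpha t by (simp add: add_pos_nonneg)

text \<open>Both sides have the same power \<open>- \<gamma>\<close>, since
  \<open>1 - 1 / \<alpha> = - 1 / \<gamma>\<close>, and this power is injective on positive
  numbers.\<close>

lemma m_at_characteristic: "m t x = m0 y * (1 + \<alpha> * u0 y powr \<alpha> * t) powr (1 - 1 / \<alpha>)"
proof -
  let ?E = "1 + \<alpha> * u0 y powr \<alpha> * t"
  let ?X = "m0 y * ?E powr (1 - 1 / \<alpha>)"
  have X: "0 < ?X" using y one_plus_pos by simp
  have "(1 - 1 / \<alpha>) * (- \<gamma>) = 1"
    using alpha by (simp add: \<gamma>_def field_simps)
  then have "?X powr (- \<gamma>) = m0 y powr (- \<gamma>) * ?E"
    using y one_plus_pos by (simp add: powr_mult powr_powr)
  also have "\<dots> = m t x powr (- \<gamma>)"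
    using kernel_along_characteristic[OF t(1) y(2,3)] eq x by simp
  finally show ?thesis
    using powr_neg_gamma_le_iff[OF X m_x_pos] powr_neg_gamma_le_iff[OF m_x_pos X] by simp
qed

text \<open>
  As a function of \<open>x\<close>, the Hopf--Lax competitor starting at \<open>y\<close> touches
  \<open>m t x powr (- \<gamma>)\<close> from above.
\<close>

lemma m_\<rho>_at_characteristic: "m_\<rho> t x = (u0 y powr (- \<alpha>) + \<alpha> * t) powr (- (1 / \<alpha>))"
proof -
  define A where "A = \<alpha> * t"
  define d where "d = x - y"
  let ?E = "1 + \<alpha> * u0 y powr \<alpha> * t"
  define f where "f = (\<lambda>\<xi>. m0 y powr (- \<gamma>) + A powr (1 + \<gamma>) * (\<xi> - y) powr (- \<gamma>) - m t \<xi> powr (- \<gamma>))"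
  have Ad: "0 < A" "0 < d" using alpha t y_less_x by (auto simp: A_def d_def)
  have d_pos: "0 < d" by (rule Ad)
  have neg_eq: "- (1 + \<gamma>) = - \<gamma> - 1" by simp
  have "(f has_real_derivative
      A powr (1 + \<gamma>) * (- \<gamma> * d powr (- \<gamma> - 1)) - (- \<gamma> * m t x powr (- \<gamma> - 1) * m_\<rho> t x)) (at x)"
    unfolding f_def d_def
    by (rule derivative_eq_intros DERIV_fun_powr m_\<rho>_deriv refl
        | use m_x_pos y_less_x y t in \<open>simp add: algebra_simps\<close>)+
  \<comment> \<open>Within distance \<open>d = x - y\<close> of \<open>x\<close> the point stays to
    the right of \<open>y\<close>, where \<open>hopf_lax_le\<close> makes \<open>f\<close>
    nonnegative; \<open>f x = 0\<close> by \<open>eq\<close>.\<close>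
  moreover have "\<forall>\<xi>. \<bar>x - \<xi>\<bar> < d \<longrightarrow> f x \<le> f \<xi>"
  proof (intro allI impI)
    fix \<xi> assume "\<bar>x - \<xi>\<bar> < d"
    then have "y < \<xi>" by (auto simp: d_def)
    then show "f x \<le> f \<xi>"
      using hopf_lax_le[of t y \<xi>] t y eq by (simp add: f_def A_def)
  qed
  ultimately have "A powr (1 + \<gamma>) * (- \<gamma> * d powr (- \<gamma> - 1)) - (- \<gamma> * m t x powr (- \<gamma> - 1) * m_\<rho> t x) = 0"
    by (rule DERIV_local_min[OF _ d_pos])
  then have "\<gamma> * (m t x powr (- \<gamma> - 1) * m_\<rho> t x) = \<gamma> * (A powr (1 + \<gamma>) * d powr (- \<gamma> - 1))"
    by (auto simp: algebra_simps)
  then have "m t x powr (- (1 + \<gamma>)) * m_\<rho> t x = A powr (1 + \<gamma>) * d powr (- (1 + \<gamma>))"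
    unfolding neg_eq using gamma by simp
  then have "m_\<rho> t x = (m t x * A / d) powr (1 + \<gamma>)"
    using m_x_pos Ad by (simp only: powr_minus) (simp add: powr_mult powr_divide field_simps)
  also have "d = A * m0 y * u0 y powr (\<alpha> - 1)"
    by (simp add: d_def x A_def)
  also have "m t x * A / (A * m0 y * u0 y powr (\<alpha> - 1)) = ?E powr (1 - 1 / \<alpha>) * u0 y powr (1 - \<alpha>)"
    using Ad y by (simp add: m_at_characteristic powr_diff)
  also have "\<dots> powr (1 + \<gamma>) = ?E powr ((1 - 1 / \<alpha>) * (1 + \<gamma>)) * u0 y powr ((1 - \<alpha>) * (1 + \<gamma>))"
    by (simp add: powr_mult powr_powr)
  also have "(1 - 1 / \<alpha>) * (1 + \<gamma>) = - (1 / \<alpha>)"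
    using alpha by (simp add: \<gamma>_def field_simps)
  \<comment> \<open>The number 1 is written as this product to merge both powers into one with
    exponent \<open>- (1 / \<alpha>)\<close>.\<close>
  also have "(1 - \<alpha>) * (1 + \<gamma>) = - \<alpha> * - (1 / \<alpha>)"
    using alpha gamma(2) by (simp add: mult.commute)
  also have "?E powr (- (1 / \<alpha>)) * u0 y powr (- \<alpha> * - (1 / \<alpha>)) = (u0 y powr (- \<alpha>) * ?E) powr (- (1 / \<alpha>))"
    using one_plus_pos by (simp add: powr_mult powr_powr)
  also have "u0 y powr (- \<alpha>) * ?E = u0 y powr (- \<alpha>) + \<alpha> * t"
    using y by (simp add: powr_minus field_simps)
  finally show ?thesis .
qed

end

section \<open>The derivative at the boundary \<rho> = 0\<close>

text \<open>The left side is the solution with linear datum \<open>p * \<rho>\<close>. Inserting the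
  foot of its characteristic into \<open>hopf_lax_le\<close> gives the comparison.\<close>

lemma m_ge_near_zero:
  assumes t: "0 < t" "t \<le> T" and p: "0 < p" and x: "0 < x"
    and lower: "\<And>y. 0 < y \<Longrightarrow> y < x \<Longrightarrow> p * y \<le> m0 y"
  shows "(p powr (- \<alpha>) + \<alpha> * t) powr (- (1 / \<alpha>)) * x \<le> m t x"
proof -
  let ?E = "1 + \<alpha> * p powr \<alpha> * t"
  let ?U = "(p powr (- \<alpha>) + \<alpha> * t) powr (- (1 / \<alpha>))"
  \<comment> \<open>For the datum \<open>p * \<rho>\<close> the characteristic from \<open>y\<close>
    ends at \<open>y * ?E\<close>, so this one ends at \<open>x\<close>.\<close>
  define y where "y = x / ?E"
  have E: "1 < ?E" using alpha t p by simp
  have "0 < x / e \<and> x / e < x" if "1 < e" for e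
    using that x by (simp add: divide_less_eq)
  from this[OF E] have y: "0 < y" "y < x" by (simp_all add: y_def)
  have py: "0 < p * y" "p * y \<le> m0 y" using y p lower[of y] by auto
  have mpos: "0 < m t x" using m_pos[of t x] m0_mono[of y x] y t py by simp
  have "0 < p powr (- \<alpha>) + \<alpha> * t" using alpha t p by (intro add_pos_pos mult_pos_pos) auto
  then have U: "0 < ?U" by simp
  have diff: "x - y = \<alpha> * (p * y) * p powr (\<alpha> - 1) * t"
    using E p by (simp add: y_def powr_diff field_simps)
  have "m t x powr (- \<gamma>) \<le> m0 y powr (- \<gamma>) + (\<alpha> * t) powr (1 + \<gamma>) * (x - y) powr (- \<gamma>)"
    by (rule hopf_lax_le) (use t y py in auto)
  also have "\<dots> \<le> (p * y) powr (- \<gamma>) + (\<alpha> * t) powr (1 + \<gamma>) * (x - y) powr (- \<gamma>)"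
    using powr_neg_gamma_le_iff[of "m0 y" "p * y"] py by simp
  also have "\<dots> = (p * y) powr (- \<gamma>) * ?E"
    unfolding diff by (rule kernel_along_characteristic) (use t py p in auto)
  also have "\<dots> = (p powr (- \<alpha>)) powr (1 + \<gamma>) * ?E powr (1 + \<gamma>) * x powr (- \<gamma>)"
  proof -
    have "(p powr (- \<alpha>)) powr (1 + \<gamma>) = p powr (- \<gamma>)"
      using gamma(3) by (simp add: powr_powr)
    then show ?thesis
      using E x p by (simp add: y_def powr_mult powr_divide powr_add powr_minus field_simps)
  qed
  also have "\<dots> = (p powr (- \<alpha>) * ?E) powr (1 + \<gamma>) * x powr (- \<gamma>)"
    using E by (simp add: powr_mult)
  also have "p powr (- \<alpha>) * ?E = p powr (- \<alpha>) + \<alpha> * t"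
    using p by (simp add: powr_minus field_simps)
  also have "(p powr (- \<alpha>) + \<alpha> * t) powr (1 + \<gamma>) * x powr (- \<gamma>) = (?U * x) powr (- \<gamma>)"
  proof -
    have "- (1 / \<alpha>) * - \<gamma> = 1 + \<gamma>" using alpha by (simp add: \<gamma>_def field_simps)
    then show ?thesis
      by (simp only: powr_mult powr_powr)
  qed
  finally show ?thesis
    using powr_neg_gamma_le_iff[OF mpos, of "?U * x"] U x by simp
qed

text \<open>Unlike the lower bound, this needs every competitor: at the minimiser for
  \<open>m0\<close>, the datum is replaced by \<open>p * y\<close>, and
  \<open>powr_sum_ge_powr_sum\<close> bounds all competitors for linear data at once.\<close>

lemma m_le_near_zero:
  assumes t: "0 < t" "t \<le> T" and p: "0 < p" and x: "0 < x" "0 < m0 x"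
    and upper: "\<And>y. 0 < y \<Longrightarrow> y < x \<Longrightarrow> m0 y \<le> p * y"
  shows "m t x \<le> (p powr (- \<alpha>) + \<alpha> * t) powr (- (1 / \<alpha>)) * x"
proof -
  let ?U = "(p powr (- \<alpha>) + \<alpha> * t) powr (- (1 / \<alpha>))"
  have "0 < p powr (- \<alpha>) + \<alpha> * t" using alpha t p by (intro add_pos_pos mult_pos_pos) auto
  then have U: "0 < ?U" by simp
  have mpos: "0 < m t x" using m_pos[of t x] x t by simp
  obtain y where y: "0 < y" "y < x" "0 < m0 y"
    and eq: "m t x powr (- \<gamma>) = m0 y powr (- \<gamma>) + (\<alpha> * t) powr (1 + \<gamma>) * (x - y) powr (- \<gamma>)"
    using hopf_lax_minimizer[OF t x] by metis
  have "- (1 / \<alpha>) * - \<gamma> = 1 + \<gamma>" using alpha by (simp add: \<gamma>_def field_simps)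
  then have "(?U * x) powr (- \<gamma>) = (p powr (- \<alpha>) + \<alpha> * t) powr (1 + \<gamma>) * (y + (x - y)) powr (1 - (1 + \<gamma>))"
    by (simp only: powr_mult powr_powr) simp
  also have "\<dots> \<le> (p powr (- \<alpha>)) powr (1 + \<gamma>) * y powr (1 - (1 + \<gamma>))
      + (\<alpha> * t) powr (1 + \<gamma>) * (x - y) powr (1 - (1 + \<gamma>))"
    by (rule powr_sum_ge_powr_sum) (use p alpha t y gamma in auto)
  also have "\<dots> = (p * y) powr (- \<gamma>) + (\<alpha> * t) powr (1 + \<gamma>) * (x - y) powr (- \<gamma>)"
    using gamma(3) by (simp add: powr_powr powr_mult)
  also have "\<dots> \<le> m t x powr (- \<gamma>)"
    using powr_neg_gamma_le_iff[of "p * y" "m0 y"] y p upper[of y] eq by simp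
  finally show ?thesis
    using powr_neg_gamma_le_iff[OF _ mpos, of "?U * x"] U x by simp
qed

text \<open>For slopes \<open>p\<close> on either side of \<open>u0 0\<close>, the line
  \<open>p * y\<close> bounds \<open>m0\<close> near 0, so the quotient \<open>m t x / x\<close> is
  eventually bounded by \<open>U p\<close> on the matching side. Continuity of \<open>U\<close> at
  \<open>u0 0\<close> lets \<open>p\<close> tend to \<open>u0 0\<close>.\<close>

lemma m_deriv_at_zero:
  assumes t: "0 < t" "t \<le> T" and u: "0 < u0 0"
  shows "((\<lambda>\<rho>. m t \<rho>) has_real_derivative (u0 0 powr (- \<alpha>) + \<alpha> * t) powr (- (1 / \<alpha>))) (at 0 within {0..})"
proof -
  define U where "U = (\<lambda>p. (p powr (- \<alpha>) + \<alpha> * t) powr (- (1 / \<alpha>)))"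
  have lim: "((\<lambda>y. m0 y / y) \<longlongrightarrow> u0 0) (at_right 0)"
    using m0_deriv[of 0] m0_zero by (simp add: has_field_derivative_iff at_within_Ici_at_right)
  have "0 < u0 0 powr (- \<alpha>) + \<alpha> * t" using alpha t u by (intro add_pos_pos mult_pos_pos) auto
  then have "isCont U (u0 0)"
    unfolding U_def using u by (intro continuous_intros) auto
  then have contU: "(U \<longlongrightarrow> U (u0 0)) (at (u0 0))"
    by (simp add: isCont_def)
  have lower: "\<forall>\<^sub>F x in at_right 0. U p \<le> m t x / x" if p: "0 < p" "p < u0 0" for p
  proof -
    have "\<forall>\<^sub>F y in at_right 0. p < m0 y / y"
      using order_tendstoD(1)[OF lim p(2)] .
    then obtain b where b: "0 < b" "\<And>y. 0 < y \<Longrightarrow> y < b \<Longrightarrow> p < m0 y / y"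
      unfolding eventually_at_right_field by auto
    have "U p \<le> m t x / x" if "x \<in> {0<..<b}" for x
    proof -
      have "p * y \<le> m0 y" if "0 < y" "y < x" for y
        using b(2)[of y] that \<open>x \<in> _\<close> by (simp add: field_simps)
      then show ?thesis
        using m_ge_near_zero[OF t p(1), of x] \<open>x \<in> _\<close> by (simp add: U_def field_simps)
    qed
    then show ?thesis
      using eventually_at_right_real[OF b(1)] by (auto elim: eventually_mono)
  qed
  have upper: "\<forall>\<^sub>F x in at_right 0. m t x / x \<le> U p" if p: "u0 0 < p" for p
  proof -
    have "\<forall>\<^sub>F y in at_right 0. 0 < m0 y / y \<and> m0 y / y < p"
      using order_tendstoD(1)[OF lim u] order_tendstoD(2)[OF lim p] by eventually_elim simp
    then obtain b where b: "0 < b" "\<And>y. 0 < y \<Longrightarrow> y < b \<Longrightarrow> 0 < m0 y / y \<and> m0 y / y < p"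
      unfolding eventually_at_right_field by auto
    have "m t x / x \<le> U p" if "x \<in> {0<..<b}" for x
    proof -
      have "m0 y \<le> p * y" if "0 < y" "y < x" for y
        using b(2)[of y] that \<open>x \<in> _\<close> by (simp add: field_simps)
      moreover have "0 < m0 x" using b(2)[of x] that by (simp add: zero_less_divide_iff)
      ultimately show ?thesis
        using m_le_near_zero[OF t _ _ _, of p x] \<open>x \<in> _\<close> p u by (simp add: U_def field_simps)
    qed
    then show ?thesis
      using eventually_at_right_real[OF b(1)] by (auto elim: eventually_mono)
  qed
  have "((\<lambda>x. m t x / x) \<longlongrightarrow> U (u0 0)) (at_right 0)"
  proof (rule order_tendstoI)
    fix a assume "a < U (u0 0)"
    then have "\<forall>\<^sub>F p in at_left (u0 0). a < U p"
      using order_tendstoD(1)[OF contU] by (auto simp: eventually_at_split)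
    moreover have "\<forall>\<^sub>F p in at_left (u0 0). p \<in> {0<..<u0 0}"
      by (rule eventually_at_left_real[OF u])
    ultimately have "\<forall>\<^sub>F p in at_left (u0 0). a < U p \<and> 0 < p \<and> p < u0 0"
      by eventually_elim auto
    then obtain p where "a < U p" "0 < p" "p < u0 0"
      using eventually_happens'[OF trivial_limit_at_left_real] by blast
    with lower[of p] show "\<forall>\<^sub>F x in at_right 0. a < m t x / x"
      by (auto elim: eventually_mono)
  next
    fix a assume "U (u0 0) < a"
    then have "\<forall>\<^sub>F p in at_right (u0 0). U p < a"
      using order_tendstoD(2)[OF contU] by (auto simp: eventually_at_split)
    moreover have "\<forall>\<^sub>F p in at_right (u0 0). u0 0 < p"
      by (rule eventually_at_right_less)
    ultimately have "\<forall>\<^sub>F p in at_right (u0 0). U p < a \<and> u0 0 < p"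
      by eventually_elim auto
    then obtain p where "U p < a" "u0 0 < p"
      using eventually_happens'[OF trivial_limit_at_right_real] by blast
    with upper[of p] show "\<forall>\<^sub>F x in at_right 0. m t x / x < a"
      by (auto elim: eventually_mono)
  qed
  then show ?thesis
    using m_at_zero[of t] t by (simp add: has_field_derivative_iff at_within_Ici_at_right U_def)
qed

text \<open>Treated apart because \<open>0 powr (- \<alpha>)\<close> is 0 in HOL; the squeeze
  between 0 and \<open>m0\<close> gives the derivative directly.\<close>

lemma m_deriv_at_zero_degenerate:
  assumes t: "0 < t" "t \<le> T" and u: "u0 0 = 0"
  shows "((\<lambda>\<rho>. m t \<rho>) has_real_derivative 0) (at 0 within {0..})"
proof -
  have lim: "((\<lambda>y. m0 y / y) \<longlongrightarrow> 0) (at_right 0)"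
    using m0_deriv[of 0] m0_zero u by (simp add: has_field_derivative_iff at_within_Ici_at_right)
  have "((\<lambda>x. m t x / x) \<longlongrightarrow> 0) (at_right 0)"
  proof (rule real_tendsto_sandwich[OF _ _ tendsto_const lim])
    show "\<forall>\<^sub>F x in at_right 0. 0 \<le> m t x / x" "\<forall>\<^sub>F x in at_right 0. m t x / x \<le> m0 x / x"
      using m_nonneg_le t by (auto simp: eventually_at_filter divide_right_mono)
  qed
  then show ?thesis
    using m_at_zero[of t] t by (simp add: has_field_derivative_iff at_within_Ici_at_right)
qed

section \<open>Identification of the minimiser by no-crossing\<close>

lemma solution_along_characteristic:
  assumes nc: "characteristics_do_not_cross \<alpha> m0 u0 T" and t: "0 \<le> t" "t \<le> T" and \<rho>0: "0 \<le> \<rho>0"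
  shows "m t (characteristic \<alpha> m0 u0 \<rho>0 t)
        = m0 \<rho>0 * (1 + \<alpha> * u0 \<rho>0 powr \<alpha> * t) powr (1 - 1 / \<alpha>) \<and>
      ((\<lambda>\<rho>. m t \<rho>) has_real_derivative u_along_characteristic \<alpha> u0 \<rho>0 t)
        (at (characteristic \<alpha> m0 u0 \<rho>0 t) within {0..})"
proof -
  have inj: "y = z" if "0 \<le> y" "0 \<le> z" "characteristic \<alpha> m0 u0 y t = characteristic \<alpha> m0 u0 z t" for y z
    using nc t that by (auto simp: characteristics_do_not_cross_def dest: inj_onD)
  consider "t = 0" | "0 < t" "\<rho>0 = 0" | "0 < t" "0 < \<rho>0" "u0 \<rho>0 = 0" "m0 \<rho>0 = 0"
    | "0 < t" "0 < \<rho>0" "u0 \<rho>0 = 0" "0 < m0 \<rho>0" | "0 < t" "0 < \<rho>0" "0 < u0 \<rho>0"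
    using t \<rho>0 u0_nonneg[OF \<rho>0] m0_nonneg[OF \<rho>0] by (auto simp: less_le)
  then show ?thesis
  proof cases
    case 1
    have "((\<lambda>\<rho>. m 0 \<rho>) has_real_derivative u0 \<rho>0) (at \<rho>0 within {0..})"
      by (rule has_field_derivative_transform_within[OF m0_deriv[OF \<rho>0] zero_less_one])
        (use \<rho>0 m_init in auto)
    moreover have "u_along_characteristic \<alpha> u0 \<rho>0 0 = u0 \<rho>0"
      using alpha u0_nonneg[OF \<rho>0] by (auto simp: u_along_characteristic_def powr_powr)
    ultimately show ?thesis
      using 1 \<rho>0 m_init by (cases "u0 \<rho>0 = 0") (simp_all add: characteristic_def)
  next
    case 2
    \<comment> \<open>The characteristic from 0 stays at 0 even if \<open>u0 0\<close> is positive,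
      because its speed contains the factor \<open>m0 0 = 0\<close>.\<close>
    have "characteristic \<alpha> m0 u0 0 t = 0" by (simp add: characteristic_def m0_zero)
    then show ?thesis
      using 2 t m_at_zero[of t] m_deriv_at_zero[of t] m_deriv_at_zero_degenerate[of t] u0_nonneg[of 0] m0_zero
      by (cases "u0 0 = 0") (auto simp: u_along_characteristic_def less_le)
  next
    case 3
    have m: "m t \<rho>0 = 0" using m_nonneg_le[of t \<rho>0] 3 t by simp
    \<comment> \<open>The nonnegative function \<open>m t\<close> vanishes at
      \<open>\<rho>0\<close>, which is therefore an interior minimum.\<close>
    have "m_\<rho> t \<rho>0 = 0"
    proof (rule DERIV_local_min[where d = \<rho>0])
      show "((\<lambda>r. m t r) has_real_derivative m_\<rho> t \<rho>0) (at \<rho>0)"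
        using m_\<rho>_deriv 3 t by simp
      show "\<forall>y. \<bar>\<rho>0 - y\<bar> < \<rho>0 \<longrightarrow> m t \<rho>0 \<le> m t y"
        using m_nonneg_le t m by auto
    qed (use 3 in simp)
    then have "((\<lambda>r. m t r) has_real_derivative 0) (at \<rho>0 within {0..})"
      using has_field_derivative_at_within[OF m_\<rho>_deriv[of t \<rho>0]] 3 t by simp
    then show ?thesis
      using 3 m by (simp add: characteristic_def u_along_characteristic_def)
  next
    case 4
    \<comment> \<open>This case is contradictory: the minimiser's characteristic reaches
      \<open>\<rho>0\<close> at time \<open>t\<close>, where the constant characteristic from
      \<open>\<rho>0\<close> already is.\<close>
    obtain y where y: "0 < y" "y < \<rho>0" "0 < u0 y" "\<rho>0 = y + \<alpha> * m0 y * u0 y powr (\<alpha> - 1) * t"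
      using hopf_lax_minimizer[of t \<rho>0] 4 t by metis
    have "characteristic \<alpha> m0 u0 y t = \<rho>0"
      using y(3,4) by (simp add: characteristic_def)
    also have "\<rho>0 = characteristic \<alpha> m0 u0 \<rho>0 t"
      using 4 by (simp add: characteristic_def)
    finally have "y = \<rho>0"
      by (rule inj[rotated 2]) (use y(1) 4(2) in auto)
    with y(2) show ?thesis by simp
  next
    case 5
    \<comment> \<open>Otherwise \<open>\<rho>0\<close> would be an interior minimum of
      \<open>m0\<close>, contradicting the positive slope.\<close>
    have m0: "0 < m0 \<rho>0"
    proof (rule ccontr)
      assume "\<not> 0 < m0 \<rho>0"
      then have "m0 \<rho>0 = 0" using m0_nonneg[OF \<rho>0] by simp
      then have "\<forall>y. \<bar>\<rho>0 - y\<bar> < \<rho>0 \<longrightarrow> m0 \<rho>0 \<le> m0 y"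
        using m0_nonneg by auto
      then show False
        using DERIV_local_min[OF m0_deriv_at[of \<rho>0] _, of \<rho>0] 5 by simp
    qed
    define x where "x = \<rho>0 + \<alpha> * m0 \<rho>0 * u0 \<rho>0 powr (\<alpha> - 1) * t"
    have x: "\<rho>0 < x" "characteristic \<alpha> m0 u0 \<rho>0 t = x"
      using m0 5 alpha by (simp_all add: x_def characteristic_def)
    have m0_x: "0 < m0 x"
      using m0 m0_mono[of \<rho>0 x] x(1) \<rho>0 by simp
    \<comment> \<open>The minimiser for the endpoint \<open>x\<close> has a characteristic ending at
      \<open>x\<close> too, so injectivity identifies it with \<open>\<rho>0\<close>.\<close>
    obtain y where y: "0 < y" "0 < u0 y" "x = y + \<alpha> * m0 y * u0 y powr (\<alpha> - 1) * t"
      and eq: "m t x powr (- \<gamma>) = m0 y powr (- \<gamma>) + (\<alpha> * t) powr (1 + \<gamma>) * (x - y) powr (- \<gamma>)"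
      by (rule hopf_lax_minimizer[OF 5(1) t(2) less_trans[OF 5(2) x(1)] m0_x])
    have "characteristic \<alpha> m0 u0 y t = characteristic \<alpha> m0 u0 \<rho>0 t"
      unfolding x(2) using y(2,3) by (simp add: characteristic_def)
    then have "y = \<rho>0"
      by (rule inj[rotated 2]) (use y(1) 5(2) in auto)
    note \<rho>0_x = 5(1) t(2) 5(2) m0 5(3) x_def eq[unfolded \<open>y = \<rho>0\<close>]
    have "((\<lambda>r. m t r) has_real_derivative m_\<rho> t x) (at x within {0..})"
      by (rule has_field_derivative_at_within, rule m_\<rho>_deriv) (use 5(1,2) t(2) x(1) in linarith)+
    moreover have "u_along_characteristic \<alpha> u0 \<rho>0 t = m_\<rho> t x"
      using 5(3) m_\<rho>_at_characteristic[OF \<rho>0_x] by (simp add: u_along_characteristic_def)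
    ultimately show ?thesis
      unfolding x(2) using m_at_characteristic[OF \<rho>0_x] by (simp only: simp_thms)
  qed
qed

end

theorem theorem3p1:
  fixes \<alpha> T :: real and m0 u0 :: "real \<Rightarrow> real" and m :: "real \<Rightarrow> real \<Rightarrow> real"
  assumes "0 < \<alpha>" and "\<alpha> < 1"
    and "m0 0 = 0"
    and "\<And>\<rho>. \<rho> \<ge> 0 \<Longrightarrow> (m0 has_real_derivative u0 \<rho>) (at \<rho> within {0..})"
    and "\<And>\<rho>. \<rho> \<ge> 0 \<Longrightarrow> u0 \<rho> \<ge> 0"
    and "classical_solution \<alpha> T m0 m"
    and "characteristics_do_not_cross \<alpha> m0 u0 T"
  shows "\<forall>t\<in>{0..T}. \<forall>\<rho>0\<ge>0.
      m t (characteristic \<alpha> m0 u0 \<rho>0 t)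
        = m0 \<rho>0 * (1 + \<alpha> * u0 \<rho>0 powr \<alpha> * t) powr (1 - 1 / \<alpha>) \<and>
      ((\<lambda>\<rho>. m t \<rho>) has_real_derivative u_along_characteristic \<alpha> u0 \<rho>0 t)
        (at (characteristic \<alpha> m0 u0 \<rho>0 t) within {0..})"
proof -
  obtain m_t m_\<rho> where
    "continuous_on ({0<..T} \<times> {0<..}) (\<lambda>(t, \<rho>). m_t t \<rho>)"
    "continuous_on ({0<..T} \<times> {0<..}) (\<lambda>(t, \<rho>). m_\<rho> t \<rho>)"
    "\<forall>t\<in>{0<..T}. \<forall>\<rho>>0.
       ((\<lambda>s. m s \<rho>) has_real_derivative m_t t \<rho>) (at t within {0..T}) \<and>
       ((\<lambda>r. m t r) has_real_derivative m_\<rho> t \<rho>) (at \<rho>) \<and>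
       m_\<rho> t \<rho> \<ge> 0 \<and> m_t t \<rho> + m t \<rho> * m_\<rho> t \<rho> powr \<alpha> = 0"
    using assms(6) unfolding classical_solution_def by blast
  then interpret mass_solution \<alpha> T m0 u0 m m_t m_\<rho>
    using assms(1-6) unfolding mass_solution_def classical_solution_def by auto
  show ?thesis
    using solution_along_characteristic assms(7) by auto
qed

end
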